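(* Let $q\in\mathbb{C}$, $s\in\mathbb{N}_0$, $\alpha_0,\dots,\alpha_s\in\mathbb{C}$, $n\ge1$, and let $\lambda_{n-1}\ge\lambda_{n-2}\ge\cdots\ge\lambda_0\ge0$ be integers. Let $\mathbf{k}=(k_0,\dots,k_s)\in\mathbb{N}_0^{s+1}$. Then $$m_{\mathbf{k}}(B_n(\lambda);q)=q^{\lambda_{n-1}+\sum_{j=0}^s(j-1)k_j}\,m_{\mathbf{k}}(B_{n-1}(\lambda);q)+\sum_{r=0}^s\alpha_r\Big[\lambda_{n-1}+\sum_{j=0}^s(j-1)k_j-(r-1)\Big]_q m_{\mathbf{k}^{(r)}}(B_{n-1}(\lambda);q),$$ where $\mathbf{k}^{(r)}=(k_0-\delta_{r,0},\dots,k_s-\delta_{r,s})$ and only summands with $\mathbf{k}^{(r)}\in\mathbb{N}_0^{s+1}$ contribute. Moreover $m_{\mathbf{0}}(B_n(\lambda);q)=q^{|\lambda|}$ with $|\lambda|=\lambda_{n-1}+\cdots+\lambda_0$.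
   Context: $B_n(\lambda)$ is the Ferrers board (top-aligned columns) with $n$ columns whose heights, from left to right, are $\lambda_{n-1},\lambda_{n-2},\dots,\lambda_0$; $B_{n-1}(\lambda)$ is the board with columns of heights $\lambda_{n-2},\dots,\lambda_0$ (i.e. $B_n(\lambda)$ with its leftmost column removed). $[m]_q=1+q+\cdots+q^{m-1}$ for $m\ge1$, $[m]_q=0$ for $m\le0$. $\boldsymbol{\alpha}^{\mathbf{k}}=\prod_j\alpha_j^{k_j}$. Mixed rook placements (Goldman–Haglund row creation rule): let $B$ have columns $c_1,\dots,c_N$ from left to right with heights $h_1\ge\cdots\ge h_N\ge0$. A mixed rook placement of type $\mathbf{k}$ is built by processing columns from right to left; in each column one places either no rook or one rook of some weight $w\in\{0,\dots,s\}$; a rook of weight $w$ occupies its row (unavailable in all columns to its left) and creates $w$ new rows extending all columns to its left. Concretely column $c$ has $a_c=h_c+\sum(w-1)$ available cells, the sum over rooks already placed in columns to its right ($a_c\ge0$ always); available cells are ordered bottom (position 1) to top (position $a_c$), and a rook in column $c$ sits at a position $p_c\in\{1,\dots,a_c\}$. There are exactly $k_w$ rooks of weight $w$. $\mathcal{M}_{\mathbf{k}}(B)$ is the set of such placements. Empty boxes: all $a_c$ available cells of a column without a rook, and the $p_c-1$ available cells below the rook in a column with a rook. $m_{\mathbf{k}}(B;q)=\boldsymbol{\alpha}^{\mathbf{k}}\sum_{\phi\in\mathcal{M}_{\mathbf{k}}(B)}q^{\#\text{empty boxes of }\phi}$ (zero if $\mathcal{M}_{\mathbf{k}}(B)$ is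 empty). *)

theory Defs
  imports Complex_Main
begin

text \<open>
  A Ferrers board is given by the list of its column heights, from left to right.  A mixed
  placement on it is a list of the same length whose entry for a column is \<open>None\<close> (no rook) or
  \<open>Some (w, p)\<close> (a rook of weight \<open>w\<close> at position \<open>p\<close>, where the available cells of the column
  are numbered from bottom to top starting with 1).
\<close>

type_synonym board = "nat list"
type_synonym placement = "(nat \<times> nat) option list"

text \<open>\<open>B\<^sub>n(\<lambda>)\<close> has column heights \<open>\<lambda>\<^sub>n\<^sub>-\<^sub>1, \<dots>, \<lambda>\<^sub>0\<close>.\<close>

definition ferrers_board :: "nat \<Rightarrow> (nat \<Rightarrow> nat) \<Rightarrow> board" where
  "ferrers_board n lam = map lam (rev [0..<n])"

text \<open>
  A rook of weight \<open>w\<close> uses up one row and creates \<open>w\<close> new ones in all columns to its left, i.e.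
  in the columns of smaller list index.
\<close>

definition row_change :: "(nat \<times> nat) option \<Rightarrow> int" where
  "row_change x = (case x of None \<Rightarrow> 0 | Some (w, p) \<Rightarrow> int w - 1)"

definition available :: "board \<Rightarrow> placement \<Rightarrow> nat \<Rightarrow> int" where
  "available B \<phi> c = int (B ! c) + (\<Sum>d\<in>{c<..<length B}. row_change (\<phi> ! d))"

text \<open>Weights range over \<open>{0, \<dots>, s}\<close>; of the type vector \<open>k\<close> only \<open>k 0, \<dots>, k s\<close> matter.\<close>

definition mixed_placements :: "nat \<Rightarrow> (nat \<Rightarrow> nat) \<Rightarrow> board \<Rightarrow> placement set" where
  "mixed_placements s k B = {\<phi>. length \<phi> = length B \<and>
     (\<forall>c<length B. \<forall>w p. \<phi> ! c = Some (w, p) \<longrightarrow> w \<le> s \<and> 1 \<le> p \<and> int p \<le> available B \<phi> c) \<and>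
     (\<forall>w\<le>s. card {c. c < length B \<and> (\<exists>p. \<phi> ! c = Some (w, p))} = k w)}"

text \<open>
  The conversion \<open>nat\<close> loses nothing: on a board with weakly decreasing heights the number of
  available cells is never negative (see \<open>available_nonneg\<close> below).
\<close>

definition empty_boxes :: "board \<Rightarrow> placement \<Rightarrow> nat" where
  "empty_boxes B \<phi> =
     (\<Sum>c<length B. case \<phi> ! c of None \<Rightarrow> nat (available B \<phi> c) | Some (w, p) \<Rightarrow> p - 1)"

definition mixed_rook_number ::
    "nat \<Rightarrow> (nat \<Rightarrow> complex) \<Rightarrow> (nat \<Rightarrow> nat) \<Rightarrow> board \<Rightarrow> complex \<Rightarrow> complex" where
  "mixed_rook_number s \<alpha> k B q =
     (\<Prod>j\<le>s. \<alpha> j ^ k j) * (\<Sum>\<phi>\<in>mixed_placements s k B. q ^ empty_boxes B \<phi>)"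

text \<open>\<open>[m]\<^sub>q = 1 + q + \<dots> + q\<^sup>m\<^sup>-\<^sup>1\<close> for \<open>m \<ge> 1\<close>, and \<open>[m]\<^sub>q = 0\<close> for \<open>m \<le> 0\<close>.\<close>

definition q_bracket :: "complex \<Rightarrow> int \<Rightarrow> complex" where
  "q_bracket q m = (\<Sum>i<nat m. q ^ i)"

lemma available_nonneg:
  assumes B: "\<And>i j. i \<le> j \<Longrightarrow> j < length B \<Longrightarrow> B ! j \<le> B ! i"
    and \<phi>: "\<phi> \<in> mixed_placements s k B" and c: "c < length B"
  shows "0 \<le> available B \<phi> c"
proof -
  have "0 \<le> available B \<phi> (length B - Suc d)" if "d < length B" for d
    using that
  proof (induction d)
    case 0
    then have "{length B - Suc 0<..<length B} = {}" by auto
    then show ?case by (simp add: available_def)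
  next
    case (Suc d)
    define e where "e = length B - Suc (Suc d)"
    have e: "length B - Suc d = Suc e" "Suc e < length B" using Suc.prems by (auto simp: e_def)
    have IH: "0 \<le> available B \<phi> (Suc e)" using Suc e by simp
    have "{e<..<length B} = insert (Suc e) {Suc e<..<length B}" using e by auto
    then have av: "available B \<phi> e =
        available B \<phi> (Suc e) + int (B ! e) - int (B ! Suc e) + row_change (\<phi> ! Suc e)"
      by (simp add: available_def)
    have "B ! Suc e \<le> B ! e" using B e by simp
    moreover have "0 \<le> available B \<phi> (Suc e) + row_change (\<phi> ! Suc e)"
    proof (cases "\<phi> ! Suc e")
      case None
      then show ?thesis using IH by (simp add: row_change_def)
    next
      case (Some x)
      obtain w p where x: "x = (w, p)" by (cases x)
      have "1 \<le> p" "int p \<le> available B \<phi> (Suc e)"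
        using \<phi> e Some x by (auto simp: mixed_placements_def)
      then show ?thesis using Some x by (simp add: row_change_def)
    qed
    ultimately have "0 \<le> available B \<phi> e" using av by linarith
    then show ?case by (simp add: e_def)
  qed
  from this[of "length B - Suc c"] c show ?thesis by simp
qed

lemma finite_mixed_placements: "finite (mixed_placements s k B)"
proof -
  define H where "H = sum_list B + length B * s"
  let ?X = "insert None (Some ` ({..s} \<times> {..H}))"
  have "mixed_placements s k B \<subseteq> {\<phi>. set \<phi> \<subseteq> ?X \<and> length \<phi> = length B}"
  proof
    fix \<phi> assume \<phi>: "\<phi> \<in> mixed_placements s k B"
    then have len: "length \<phi> = length B" by (simp add: mixed_placements_def)
    have "\<phi> ! c \<in> ?X" if c: "c < length B" for c
    proof (cases "\<phi> ! c")
      case (Some x)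
      obtain w p where x: "x = (w, p)" by (cases x)
      have wp: "w \<le> s" "int p \<le> available B \<phi> c"
        using \<phi> c Some x by (auto simp: mixed_placements_def)
      have "row_change (\<phi> ! d) \<le> int s" if "d < length B" for d
        using \<phi> that by (auto simp: mixed_placements_def row_change_def split: option.split)
      then have "(\<Sum>d\<in>{c<..<length B}. row_change (\<phi> ! d))
          \<le> of_nat (card {c<..<length B}) * int s"
        by (intro sum_bounded_above) auto
      also have "\<dots> \<le> int (length B) * int s" by (intro mult_right_mono) auto
      finally have "available B \<phi> c \<le> int (B ! c) + int (length B) * int s"
        by (simp add: available_def)
      moreover have "B ! c \<le> sum_list B" using c by (simp add: elem_le_sum_list)
      ultimately have "int p \<le> int H" using wp by (simp add: H_def)
      then show ?thesis using Some x wp by auto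
    qed auto
    then have "set \<phi> \<subseteq> ?X"
      using len by (metis in_set_conv_nth subsetI)
    then show "\<phi> \<in> {\<phi>. set \<phi> \<subseteq> ?X \<and> length \<phi> = length B}"
      using len by blast
  qed
  then show ?thesis by (rule finite_subset) (intro finite_lists_length_eq, auto)
qed

end

theory Submission imports Defs begin

text \<open>
  Split the placements on a board according to the leftmost column.  Every rook of weight \<open>j\<close>
  changes the number of rows by \<open>j - 1\<close>, so the number of available cells of the leftmost column
  depends only on the type of the placement on the other columns.  An empty leftmost column
  contributes \<open>q\<close> to the power of that number; a rook of weight \<open>r\<close> in position \<open>p\<close> contributes \<open>q\<^sup>p\<^sup>-\<^sup>1\<close>, and
  the sum over \<open>p\<close> is a \<open>q\<close>-bracket.
\<close>

definition type_change :: "nat \<Rightarrow> (nat \<Rightarrow> nat) \<Rightarrow> int" where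
  "type_change s k = (\<Sum>j\<le>s. (int j - 1) * int (k j))"

text \<open>A rook in the leftmost column does not alter its own column, so the cells available to
  it are governed by the type with that rook removed. The assumption \<open>1 \<le> k r\<close>
  makes the subtraction genuine.\<close>

lemma type_change_remove:
  assumes "r \<le> s" "1 \<le> k r"
  shows "type_change s (k(r := k r - 1)) = type_change s k - (int r - 1)"
proof -
  have "type_change s (k(r := k r - 1)) =
      (int r - 1) * int (k r - 1) + (\<Sum>j\<in>{..s} - {r}. (int j - 1) * int (k j))"
    using assms by (simp add: type_change_def sum.remove[of _ r])
  moreover have "type_change s k =
      (int r - 1) * int (k r) + (\<Sum>j\<in>{..s} - {r}. (int j - 1) * int (k j))"
    using assms by (simp add: type_change_def sum.remove[of _ r])
  ultimately show ?thesis
    using assms by (simp add: of_nat_diff algebra_simps)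
qed

lemma prod_power_remove:
  fixes \<alpha> :: "nat \<Rightarrow> 'a::comm_monoid_mult"
  assumes "r \<le> s" "1 \<le> k r"
  shows "(\<Prod>j\<le>s. \<alpha> j ^ k j) = \<alpha> r * (\<Prod>j\<le>s. \<alpha> j ^ (k(r := k r - 1)) j)"
proof -
  have "\<alpha> r ^ k r = \<alpha> r * \<alpha> r ^ (k r - 1)"
    using assms by (metis Suc_diff_1 less_le_trans power_Suc zero_less_one)
  then show ?thesis
    using assms by (simp add: prod.remove[of _ r] mult.assoc)
qed

text \<open>Double counting: grouping the columns by the weight of their rook turns the column sum
  into a sum over weights, where weight \<open>j\<close> occurs \<open>k j\<close> times.\<close>

lemma sum_row_change:
  assumes "\<phi> \<in> mixed_placements s k B"
  shows "(\<Sum>d<length B. row_change (\<phi> ! d)) = type_change s k"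
proof -
  let ?C = "\<lambda>j. {c. c < length B \<and> (\<exists>p. \<phi> ! c = Some (j, p))}"
  \<comment> \<open>At most one summand is nonzero, and the bound \<open>w \<le> s\<close> ensures
    that the weight of a rook is within the range of summation.\<close>
  have "row_change (\<phi> ! d) = (\<Sum>j\<le>s. if d \<in> ?C j then int j - 1 else 0)"
    if "d < length B" for d
  proof (cases "\<phi> ! d")
    case (Some x)
    obtain w p where x: "x = (w, p)" by (cases x)
    have "w \<le> s" using assms that Some x by (auto simp: mixed_placements_def)
    then show ?thesis using that Some x by (simp add: row_change_def)
  qed (simp add: row_change_def)
  then have "(\<Sum>d<length B. row_change (\<phi> ! d)) =
      (\<Sum>d<length B. \<Sum>j\<le>s. if d \<in> ?C j then int j - 1 else 0)"
    by simp
  also have "\<dots> = (\<Sum>j\<le>s. \<Sum>d<length B. if d \<in> ?C j then int j - 1 else 0)"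
    by (rule sum.swap)
  also have "\<dots> = (\<Sum>j\<le>s. (int j - 1) * int (card (?C j)))"
  proof (rule sum.cong[OF refl])
    fix j
    have "{..<length B} \<inter> ?C j = ?C j" by auto
    then show "(\<Sum>d<length B. if d \<in> ?C j then int j - 1 else 0)
        = (int j - 1) * int (card (?C j))"
      by (simp add: sum.inter_restrict[symmetric] mult.commute del: mem_Collect_eq)
  qed
  also have "\<dots> = type_change s k"
    using assms by (simp add: type_change_def mixed_placements_def)
  finally show ?thesis .
qed

text \<open>Rooks act only on columns to their left, so a new leftmost column leaves the old ones
  unaffected.\<close>

lemma available_Cons_Suc:
  "available (h # B) (x # \<phi>) (Suc c) = available B \<phi> c"
proof -
  have "{Suc c<..<Suc (length B)} = Suc ` {c<..<length B}"
  proof (rule set_eqI)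
    fix d
    show "d \<in> {Suc c<..<Suc (length B)} \<longleftrightarrow> d \<in> Suc ` {c<..<length B}" by (cases d) auto
  qed
  then show ?thesis by (simp add: available_def sum.reindex)
qed

lemma available_Cons_0:
  "available (h # B) (x # \<phi>) 0 = int h + (\<Sum>d<length B. row_change (\<phi> ! d))"
proof -
  have "{0<..<Suc (length B)} = Suc ` {..<length B}"
  proof (rule set_eqI)
    fix d
    show "d \<in> {0<..<Suc (length B)} \<longleftrightarrow> d \<in> Suc ` {..<length B}" by (cases d) auto
  qed
  then show ?thesis by (simp add: available_def sum.reindex)
qed

lemma empty_boxes_Cons:
  "empty_boxes (h # B) (x # \<phi>) =
    (case x of None \<Rightarrow> nat (available (h # B) (x # \<phi>) 0) | Some (w, p) \<Rightarrow> p - 1)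
      + empty_boxes B \<phi>"
  by (simp add: empty_boxes_def sum.lessThan_Suc_shift available_Cons_Suc
      del: sum.lessThan_Suc cong: option.case_cong)

lemma card_weight_Cons:
  "card {c. c < length (h # B) \<and> (\<exists>p. (x # \<phi>) ! c = Some (w, p))} =
    (if \<exists>p. x = Some (w, p) then 1 else 0)
      + card {c. c < length B \<and> (\<exists>p. \<phi> ! c = Some (w, p))}"
    (is "card ?L = _ + card ?R")
proof -
  have "?L = (if \<exists>p. x = Some (w, p) then {0} else {}) \<union> Suc ` ?R"
  proof (rule set_eqI)
    fix c
    show "c \<in> ?L \<longleftrightarrow> c \<in> (if \<exists>p. x = Some (w, p) then {0} else {}) \<union> Suc ` ?R"
      by (cases c) auto
  qed
  then show ?thesis by (simp add: card_image)
qed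

lemma None_Cons_mixed_placements:
  "None # \<phi> \<in> mixed_placements s k (h # B) \<longleftrightarrow> \<phi> \<in> mixed_placements s k B"
  unfolding mixed_placements_def mem_Collect_eq card_weight_Cons
  by (simp add: All_less_Suc2 available_Cons_Suc)

text \<open>The new rook uses up one unit of \<open>k r\<close>, and the other columns must realise
  the rest of the type. By \<open>sum_row_change\<close> that reduced type alone fixes the bound on
  \<open>p\<close>.\<close>

lemma Some_Cons_mixed_placements:
  "Some (r, p) # \<phi> \<in> mixed_placements s k (h # B) \<longleftrightarrow>
    r \<le> s \<and> 1 \<le> k r \<and> \<phi> \<in> mixed_placements s (k(r := k r - 1)) B \<and>
    1 \<le> p \<and> int p \<le> int h + type_change s k - (int r - 1)"
proof -
  let ?card = "\<lambda>w. card {c. c < length B \<and> (\<exists>p. \<phi> ! c = Some (w, p))}"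
  \<comment> \<open>The equation at \<open>w = r\<close> forces \<open>1 \<le> k r\<close>;
    conversely this condition rules out truncation in \<open>k r - 1\<close>.\<close>
  have *: "(\<forall>w\<le>s. (if r = w then 1 else 0) + ?card w = k w) \<longleftrightarrow>
      1 \<le> k r \<and> (\<forall>w\<le>s. ?card w = (k(r := k r - 1)) w)" if "r \<le> s"
    using that by (auto split: if_splits)
  have "Some (r, p) # \<phi> \<in> mixed_placements s k (h # B) \<longleftrightarrow>
    r \<le> s \<and> 1 \<le> k r \<and> \<phi> \<in> mixed_placements s (k(r := k r - 1)) B \<and>
    1 \<le> p \<and> int p \<le> available (h # B) (Some (r, p) # \<phi>) 0"
    unfolding mixed_placements_def mem_Collect_eq card_weight_Cons
    using * by (auto simp: All_less_Suc2 available_Cons_Suc)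
  then show ?thesis
    \<comment> \<open>Removing \<open>One_nat_def\<close> keeps \<open>k r - 1\<close> in the form
      that \<open>type_change_remove\<close> matches.\<close>
    by (auto simp: available_Cons_0 sum_row_change type_change_remove simp del: One_nat_def)
qed

text \<open>For fixed \<open>r\<close> the range of \<open>p\<close> does not depend on
  \<open>\<phi>\<close>, hence a plain product inside the \<open>SIGMA\<close>. A nonpositive bound
  gives an empty range, in agreement with a vanishing bracket.\<close>

lemma mixed_placements_Cons:
  "mixed_placements s k (h # B) =
    (#) None ` mixed_placements s k B \<union>
    (\<lambda>(r, \<phi>, p). Some (r, p) # \<phi>) `
      (SIGMA r:{r. r \<le> s \<and> 1 \<le> k r}. mixed_placements s (k(r := k r - 1)) B
         \<times> {1..nat (int h + type_change s k - (int r - 1))})"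
    (is "_ = ?N \<union> ?f ` ?S")
proof (intro equalityI subsetI)
  fix \<psi> assume \<psi>: "\<psi> \<in> mixed_placements s k (h # B)"
  then obtain x \<phi> where x: "\<psi> = x # \<phi>"
    by (cases \<psi>) (auto simp: mixed_placements_def)
  show "\<psi> \<in> ?N \<union> ?f ` ?S"
  proof (cases x)
    case None
    then show ?thesis using \<psi> x by (simp add: None_Cons_mixed_placements)
  next
    case (Some y)
    obtain r p where y: "y = (r, p)" by (cases y)
    have "(r, \<phi>, p) \<in> ?S"
      using \<psi> unfolding x Some y Some_Cons_mixed_placements by auto
    then have "?f (r, \<phi>, p) \<in> ?f ` ?S" by (rule imageI)
    then show ?thesis using x Some y by simp
  qed
next
  fix \<psi> assume "\<psi> \<in> ?N \<union> ?f ` ?S"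
  then show "\<psi> \<in> mixed_placements s k (h # B)"
    by (auto simp: None_Cons_mixed_placements Some_Cons_mixed_placements)
qed

lemma q_bracket_eq_sum_positions:
  "q_bracket q m = (\<Sum>p\<in>{1..nat m}. q ^ (p - 1))"
  by (simp add: q_bracket_def sum.atLeast1_atMost_eq)

text \<open>
  The board has to be decreasing only to make the exponent of the first summand nonnegative
  whenever there are placements of type \<open>k\<close> on \<open>B\<close>: otherwise \<open>empty_boxes\<close> truncates to 0.
\<close>

lemma mixed_rook_number_Cons:
  assumes B: "sorted_wrt (\<ge>) (h # B)"
  shows "mixed_rook_number s \<alpha> k (h # B) q =
      q powi (int h + type_change s k) * mixed_rook_number s \<alpha> k B q
      + (\<Sum>r\<in>{r. r \<le> s \<and> 1 \<le> k r}.
           \<alpha> r * q_bracket q (int h + type_change s k - (int r - 1))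
             * mixed_rook_number s \<alpha> (k(r := k r - 1)) B q)"
proof -
  let ?M = "\<lambda>k. mixed_placements s k B"
  let ?A = "\<lambda>k. \<Prod>j\<le>s. \<alpha> j ^ k j"
  let ?R = "{r. r \<le> s \<and> 1 \<le> k r}"
  let ?P = "\<lambda>r. {1..nat (int h + type_change s k - (int r - 1))}"
  let ?k = "\<lambda>r. k(r := k r - 1)"
  let ?S = "SIGMA r:?R. ?M (?k r) \<times> ?P r"
  let ?f = "\<lambda>(r, \<phi>, p). Some (r, p) # \<phi>"
  let ?g = "\<lambda>\<phi>. q ^ empty_boxes (h # B) \<phi>"
  have fin: "finite ?R" by simp
  \<comment> \<open>Only needed for existing placements: if there are none of type \<open>k\<close>
    on \<open>B\<close>, the exponent may be negative, but the power then multiplies an empty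
    sum.\<close>
  have None: "?g (None # \<phi>) = q powi (int h + type_change s k) * q ^ empty_boxes B \<phi>"
    if \<phi>: "\<phi> \<in> ?M k" for \<phi>
  proof -
    have av: "available (h # B) (None # \<phi>) 0 = int h + type_change s k"
      using \<phi> by (simp add: available_Cons_0 sum_row_change)
    have "0 \<le> available (h # B) (None # \<phi>) 0"
    proof (rule available_nonneg)
      show "(h # B) ! j \<le> (h # B) ! i" if "i \<le> j" "j < length (h # B)" for i j
        using sorted_wrt_nth_less[OF B] that by (cases "i = j") auto
      show "None # \<phi> \<in> mixed_placements s k (h # B)"
        using \<phi> by (simp add: None_Cons_mixed_placements)
    qed simp
    then show ?thesis
      using av by (simp add: empty_boxes_Cons power_add power_int_def)
  qed
  \<comment> \<open>The two images are disjoint because their lists differ in the head,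
    \<open>None\<close> against \<open>Some\<close>.\<close>
  have "(\<Sum>\<psi>\<in>mixed_placements s k (h # B). ?g \<psi>) =
      (\<Sum>\<psi>\<in>(#) None ` ?M k. ?g \<psi>) + (\<Sum>\<psi>\<in>?f ` ?S. ?g \<psi>)"
    unfolding mixed_placements_Cons
    by (intro sum.union_disjoint finite_imageI finite_SigmaI finite_cartesian_product
          finite_mixed_placements fin) auto
  also have "(\<Sum>\<psi>\<in>(#) None ` ?M k. ?g \<psi>) =
      q powi (int h + type_change s k) * (\<Sum>\<phi>\<in>?M k. q ^ empty_boxes B \<phi>)"
    by (simp add: sum.reindex sum_distrib_left None)
  also have "(\<Sum>\<psi>\<in>?f ` ?S. ?g \<psi>) = (\<Sum>(r, \<phi>, p)\<in>?S. q ^ (p - 1) * q ^ empty_boxes B \<phi>)"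
    by (subst sum.reindex)
       (auto simp: inj_on_def empty_boxes_Cons power_add[symmetric] intro!: sum.cong)
  also have "\<dots> = (\<Sum>r\<in>?R. \<Sum>(\<phi>, p)\<in>?M (?k r) \<times> ?P r. q ^ (p - 1) * q ^ empty_boxes B \<phi>)"
    by (rule sum.Sigma[symmetric]) (simp_all add: fin finite_mixed_placements)
  \<comment> \<open>The sum over a product set factorises; \<open>sum.swap\<close> brings the sum
    over positions to the outside, as in the expanded product.\<close>
  also have "\<dots> = (\<Sum>r\<in>?R. q_bracket q (int h + type_change s k - (int r - 1))
      * (\<Sum>\<phi>\<in>?M (?k r). q ^ empty_boxes B \<phi>))"
    unfolding q_bracket_eq_sum_positions sum_product sum.cartesian_product[symmetric]
    by (intro sum.cong refl sum.swap)
  finally have "mixed_rook_number s \<alpha> k (h # B) q =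
      q powi (int h + type_change s k) * mixed_rook_number s \<alpha> k B q
      + (\<Sum>r\<in>?R. ?A k * (q_bracket q (int h + type_change s k - (int r - 1))
          * (\<Sum>\<phi>\<in>?M (?k r). q ^ empty_boxes B \<phi>)))"
    by (simp add: mixed_rook_number_def distrib_left sum_distrib_left mult_ac)
  also have "(\<Sum>r\<in>?R. ?A k * (q_bracket q (int h + type_change s k - (int r - 1))
          * (\<Sum>\<phi>\<in>?M (?k r). q ^ empty_boxes B \<phi>))) =
      (\<Sum>r\<in>?R. \<alpha> r * q_bracket q (int h + type_change s k - (int r - 1))
          * mixed_rook_number s \<alpha> (?k r) B q)"
  proof (rule sum.cong[OF refl])
    fix r assume "r \<in> ?R"
    \<comment> \<open>One factor is split off without division, so \<open>\<alpha> r = 0\<close> is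
      covered.\<close>
    then have "?A k = \<alpha> r * ?A (?k r)" by (intro prod_power_remove) auto
    then show "?A k * (q_bracket q (int h + type_change s k - (int r - 1))
          * (\<Sum>\<phi>\<in>?M (?k r). q ^ empty_boxes B \<phi>)) =
        \<alpha> r * q_bracket q (int h + type_change s k - (int r - 1))
          * mixed_rook_number s \<alpha> (?k r) B q"
      unfolding mixed_rook_number_def by (simp only: mult_ac)
  qed
  finally show ?thesis .
qed

text \<open>For the zero type no \<open>r\<close> qualifies and \<open>type_change\<close> vanishes,
  so the recurrence just multiplies by \<open>q ^ h\<close> for each column.\<close>

lemma mixed_rook_number_no_rooks:
  assumes "sorted_wrt (\<ge>) B"
  shows "mixed_rook_number s \<alpha> (\<lambda>_. 0) B q = q ^ sum_list B"
  using assms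
proof (induction B)
  case Nil
  have "mixed_placements s (\<lambda>_. 0) [] = {[]}" by (auto simp: mixed_placements_def)
  then show ?case by (simp add: mixed_rook_number_def empty_boxes_def)
next
  case (Cons h B)
  then have "mixed_rook_number s \<alpha> (\<lambda>_. 0) B q = q ^ sum_list B" by simp
  then show ?case
    unfolding mixed_rook_number_Cons[OF Cons.prems] by (simp add: type_change_def power_add)
qed

lemma ferrers_board_Suc: "ferrers_board (Suc n) lam = lam n # ferrers_board n lam"
  by (simp add: ferrers_board_def)

lemma sorted_ferrers_board:
  assumes "\<And>i j. i \<le> j \<Longrightarrow> j < n \<Longrightarrow> lam i \<le> lam j"
  shows "sorted_wrt (\<ge>) (ferrers_board n lam)"
  using assms by (auto simp: ferrers_board_def sorted_wrt_iff_nth_less rev_nth)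

lemma sum_list_ferrers_board: "sum_list (ferrers_board n lam) = (\<Sum>i<n. lam i)"
  by (induction n) (simp_all add: ferrers_board_Suc, simp add: ferrers_board_def)

theorem theorem4p19:
  fixes q :: complex and s n :: nat and \<alpha> :: "nat \<Rightarrow> complex" and lam k :: "nat \<Rightarrow> nat"
  assumes "n \<ge> 1"
    and "\<And>i j. i \<le> j \<Longrightarrow> j < n \<Longrightarrow> lam i \<le> lam j"
  shows "mixed_rook_number s \<alpha> k (ferrers_board n lam) q =
      q powi (int (lam (n - 1)) + (\<Sum>j\<le>s. (int j - 1) * int (k j)))
        * mixed_rook_number s \<alpha> k (ferrers_board (n - 1) lam) q
      + (\<Sum>r\<in>{r. r \<le> s \<and> k r \<ge> 1}. \<alpha> r
          * q_bracket q (int (lam (n - 1)) + (\<Sum>j\<le>s. (int j - 1) * int (k j)) - (int r - 1))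
          * mixed_rook_number s \<alpha> (k(r := k r - 1)) (ferrers_board (n - 1) lam) q)
    \<and> mixed_rook_number s \<alpha> (\<lambda>_. 0) (ferrers_board n lam) q = q ^ (\<Sum>i<n. lam i)"
proof -
  \<comment> \<open>The column of height \<open>lam m\<close> is the leftmost one, and removing it
    leaves the board for \<open>n - 1 = m\<close>.\<close>
  obtain m where n: "n = Suc m" using assms(1) by (cases n) auto
  have sorted: "sorted_wrt (\<ge>) (ferrers_board n lam)"
    using assms(2) by (rule sorted_ferrers_board)
  then have "sorted_wrt (\<ge>) (lam m # ferrers_board m lam)"
    by (simp add: n ferrers_board_Suc)
  from mixed_rook_number_Cons[OF this, of s \<alpha> k q] mixed_rook_number_no_rooks[OF sorted, of s \<alpha> q]
  show ?thesis
    by (simp add: n ferrers_board_Suc type_change_def sum_list_ferrers_board[symmetric])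
qed

end
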